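(* Let $\mathbb T^\omega=\mathbb T\times\mathbb T\times\cdots$ be the product of countably infinitely many copies of the one-dimensional torus $\mathbb T=\mathbb R/\mathbb Z$, and let $\mathcal T_{\mathbb T^\omega}$ be the product topology on it. Let $\rho$ be a quasimetric on $\mathbb T^\omega$ such that $\mathcal T_\rho=\mathcal T_{\mathbb T^\omega}$. Then there does not exist a Borel measure $\mu$ on $\mathbb T^\omega$ such that $(\mathbb T^\omega,\rho,\mu)$ is homogeneous in the Coifman--Weiss sense.
   Context: Quasimetric: a mapping $\rho\colon X\times X\to[0,\infty)$ on a nonempty set $X$ such that $\rho(x,y)=0$ if and only if $x=y$; $\rho(x,y)=\rho(y,x)$; and there is a constant $K\in[1,\infty)$ with $\rho(x,y)\le K(\rho(x,z)+\rho(z,y))$ for all $x,y,z\in X$. Balls and topology: $B_\rho(x,r)=\{y\in X:\rho(x,y)<r\}$ for $x\in X$, $r\in(0,\infty)$. The topology $\mathcal T_\rho$ consists of all sets $G\subset X$ such that for each $x\in G$ there is $r_x\in(0,\infty)$ with $B_\rho(x,r_x)\subset G$. (Balls need not be open, or even Borel, with respect to $\mathcal T_\rho$.) Homogeneity: given a nonempty set $X$, a quasimetric $\rho$ on $X$, and a Borel measure $\mu$ (Borel with respect to $\mathcal T_\rho$), the space $(X,\rho,\mu)$ is homogeneous in the Coifman--Weiss sense if all balls are $\mu$-measurable, $\mu(B_\rho(x,r))\in(0,\infty)$ for all $x \in X$, $r\in(0,\infty)$, and there exists a constant $C\in[1,\infty)$ such that $\mu(B_\rho(x,2r))\le C\mu(B_\rho(x,r))$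 for all $x\in X$, $r\in(0,\infty)$. *)

theory Defs
  imports "HOL-Analysis.Analysis"
begin

definition int_translate :: "real \<Rightarrow> real \<Rightarrow> bool"
  where "int_translate x y \<longleftrightarrow> x - y \<in> \<int>"

lemma equivp_int_translate: "equivp int_translate"
proof (rule equivpI)
  show "reflp int_translate"
    by (simp add: reflp_def int_translate_def)
  show "symp int_translate"
    unfolding symp_def int_translate_def by (metis Ints_minus minus_diff_eq)
  show "transp int_translate"
    unfolding transp_def int_translate_def
    by (metis Ints_add diff_add_cancel add_diff_eq)
qed

quotient_type torus = real / int_translate
  morphisms rep_torus to_torus
  by (rule equivp_int_translate)

instantiation torus :: topological_space
begin

definition open_torus :: "torus set \<Rightarrow> bool"
  where "open_torus U \<longleftrightarrow> open (to_torus -` U)"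

instance
proof
  show "open (UNIV :: torus set)"
    by (simp add: open_torus_def)
  show "open (S \<inter> T)" if "open S" "open T" for S T :: "torus set"
    using that by (simp add: open_torus_def open_Int)
  show "open (\<Union>K)" if "\<forall>S\<in>K. open S" for K :: "torus set set"
    using that by (auto simp: open_torus_def vimage_Union)
qed

end

lemma to_torus_eq_iff: "to_torus x = to_torus y \<longleftrightarrow> x - y \<in> \<int>"
  by (simp add: torus.abs_eq_iff int_translate_def)

lemma quotient_map_to_torus: "quotient_map euclidean euclidean to_torus"
proof -
  have "range to_torus = UNIV"
    by (metis Quotient3_abs_rep Quotient3_torus surj_def)
  then show ?thesis
    by (simp add: quotient_map_def open_torus_def vimage_def)
qed

definition quasimetric :: "'a set \<Rightarrow> ('a \<Rightarrow> 'a \<Rightarrow> real) \<Rightarrow> bool"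
  where "quasimetric X \<rho> \<longleftrightarrow>
    X \<noteq> {} \<and>
    (\<forall>x\<in>X. \<forall>y\<in>X. 0 \<le> \<rho> x y) \<and>
    (\<forall>x\<in>X. \<forall>y\<in>X. \<rho> x y = 0 \<longleftrightarrow> x = y) \<and>
    (\<forall>x\<in>X. \<forall>y\<in>X. \<rho> x y = \<rho> y x) \<and>
    (\<exists>K\<ge>1. \<forall>x\<in>X. \<forall>y\<in>X. \<forall>z\<in>X. \<rho> x y \<le> K * (\<rho> x z + \<rho> z y))"

definition qball :: "'a set \<Rightarrow> ('a \<Rightarrow> 'a \<Rightarrow> real) \<Rightarrow> 'a \<Rightarrow> real \<Rightarrow> 'a set"
  where "qball X \<rho> x r = {y \<in> X. \<rho> x y < r}"

definition quasimetric_topology :: "'a set \<Rightarrow> ('a \<Rightarrow> 'a \<Rightarrow> real) \<Rightarrow> 'a topology"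
  where "quasimetric_topology X \<rho> =
    topology (\<lambda>G. G \<subseteq> X \<and> (\<forall>x\<in>G. \<exists>r>0. qball X \<rho> x r \<subseteq> G))"

lemma istopology_quasimetric:
  "istopology (\<lambda>G. G \<subseteq> X \<and> (\<forall>x\<in>G. \<exists>r>0. qball X \<rho> x r \<subseteq> G))"
  unfolding istopology_def
proof (intro conjI allI impI)
  fix S T
  assume S: "S \<subseteq> X \<and> (\<forall>x\<in>S. \<exists>r>0. qball X \<rho> x r \<subseteq> S)"
    and T: "T \<subseteq> X \<and> (\<forall>x\<in>T. \<exists>r>0. qball X \<rho> x r \<subseteq> T)"
  show "S \<inter> T \<subseteq> X" using S by blast
  show "\<forall>x\<in>S \<inter> T. \<exists>r>0. qball X \<rho> x r \<subseteq> S \<inter> T"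
  proof
    fix x assume "x \<in> S \<inter> T"
    then obtain r s where "r > 0" "qball X \<rho> x r \<subseteq> S" "s > 0" "qball X \<rho> x s \<subseteq> T"
      using S T by blast
    then have "min r s > 0" "qball X \<rho> x (min r s) \<subseteq> S \<inter> T"
      by (auto simp: qball_def)
    then show "\<exists>r>0. qball X \<rho> x r \<subseteq> S \<inter> T" by blast
  qed
next
  fix \<K>
  assume K: "\<forall>S\<in>\<K>. S \<subseteq> X \<and> (\<forall>x\<in>S. \<exists>r>0. qball X \<rho> x r \<subseteq> S)"
  then show "\<Union>\<K> \<subseteq> X" by blast
  show "\<forall>x\<in>\<Union>\<K>. \<exists>r>0. qball X \<rho> x r \<subseteq> \<Union>\<K>"
  proof
    fix x assume "x \<in> \<Union>\<K>"
    then obtain S where "S \<in> \<K>" "x \<in> S" by blast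
    with K obtain r where "r > 0" "qball X \<rho> x r \<subseteq> S" by blast
    with \<open>S \<in> \<K>\<close> show "\<exists>r>0. qball X \<rho> x r \<subseteq> \<Union>\<K>" by blast
  qed
qed

lemma openin_quasimetric_topology:
  "openin (quasimetric_topology X \<rho>) G \<longleftrightarrow>
    G \<subseteq> X \<and> (\<forall>x\<in>G. \<exists>r>0. qball X \<rho> x r \<subseteq> G)"
  unfolding quasimetric_topology_def
  by (simp add: topology_inverse'[OF istopology_quasimetric])

lemma topspace_quasimetric_topology: "topspace (quasimetric_topology X \<rho>) = X"
proof
  show "topspace (quasimetric_topology X \<rho>) \<subseteq> X"
    unfolding topspace_def by (auto simp: openin_quasimetric_topology)
  have "openin (quasimetric_topology X \<rho>) X"
    by (auto simp: openin_quasimetric_topology qball_def intro: exI[of _ 1])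
  then show "X \<subseteq> topspace (quasimetric_topology X \<rho>)"
    by (rule openin_subset)
qed

definition borel_measure_on :: "'a topology \<Rightarrow> 'a measure \<Rightarrow> bool"
  where "borel_measure_on T \<mu> \<longleftrightarrow>
    space \<mu> = topspace T \<and> sets \<mu> = sigma_sets (topspace T) {U. openin T U}"

text \<open>
  Balls need not be Borel sets, so being measurable with respect to the Borel measure \<open>\<mu>\<close>
  is understood as membership in the completed sigma-algebra. On Borel sets the completed
  measure agrees with \<open>\<mu>\<close>.
\<close>

definition coifman_weiss_homogeneous ::
    "'a set \<Rightarrow> ('a \<Rightarrow> 'a \<Rightarrow> real) \<Rightarrow> 'a measure \<Rightarrow> bool"
  where "coifman_weiss_homogeneous X \<rho> \<mu> \<longleftrightarrow>
    quasimetric X \<rho> \<and>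
    borel_measure_on (quasimetric_topology X \<rho>) \<mu> \<and>
    (\<forall>x\<in>X. \<forall>r>0. qball X \<rho> x r \<in> sets (completion \<mu>)) \<and>
    (\<forall>x\<in>X. \<forall>r>0. 0 < emeasure (completion \<mu>) (qball X \<rho> x r) \<and>
                  emeasure (completion \<mu>) (qball X \<rho> x r) < \<infinity>) \<and>
    (\<exists>C::real. C \<ge> 1 \<and> (\<forall>x\<in>X. \<forall>r>0.
        emeasure (completion \<mu>) (qball X \<rho> x (2 * r))
          \<le> ennreal C * emeasure (completion \<mu>) (qball X \<rho> x r)))"

end

theory Submission
  imports Defs
begin

text \<open>
  A doubling measure bounds, by a number \<open>n\<close> independent of \<open>r\<close>, the size of every \<open>r\<close>-separated
  set contained in a ball of radius comparable to \<open>r\<close>. Hence every compact set has, at all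
  scales, open covers of multiplicity at most \<open>n\<close>, which is to say that its covering dimension is
  finite. But the infinite torus contains a copy of the Hilbert cube, and a cover of the cube by
  open sets none of which meets two opposite faces in the first \<open>n\<close> directions has multiplicity
  greater than \<open>n\<close> (Lebesgue). The latter follows from the Poincare--Miranda theorem.
\<close>

section \<open>Lebesgue's covering theorem in the Hilbert cube\<close>

text \<open>The weights \<open>(1/2)^n\<close> of the product metric sum to 2.\<close>

lemma dist_fun_le:
  fixes x y :: "'a::countable \<Rightarrow> 'b::metric_space"
  assumes "\<And>i. dist (x i) (y i) \<le> e"
  shows "dist x y \<le> 2 * e"
proof -
  have "dist x y \<le> (\<Sum>n. (1/2)^n * e)"
    unfolding dist_fun_def
  proof (rule suminf_le)
    show "(1/2)^n * min (dist (x (from_nat n)) (y (from_nat n))) 1 \<le> (1/2)^n * e" for n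
      using assms[of "from_nat n"] by (intro mult_left_mono) auto
    show "summable (\<lambda>n. (1/2)^n * min (dist (x (from_nat n)) (y (from_nat n))) 1)"
      by (rule summable_comparison_test'[of "\<lambda>n. (1/2)^n"]) (auto simp: summable_geometric_iff)
    show "summable (\<lambda>n. (1/2)^n * e)"
      by (intro summable_mult2 summable_geometric) simp
  qed
  also have "\<dots> = 2 * e"
    using suminf_geometric[of "1/2::real"] suminf_mult2[of "\<lambda>n. (1/2::real)^n" e]
    by (simp add: summable_geometric)
  finally show ?thesis .
qed

text \<open>Gaussian elimination, by induction on the set \<open>W\<close> of equations. It later
  places up to \<open>n\<close> points of \<open>n\<close>-space on a common affine
  hyperplane.\<close>

lemma homogeneous_system_nontrivial_solution:
  fixes f :: "'a \<Rightarrow> 'b \<Rightarrow> 'c::field"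
  assumes "finite W" "finite I" "card W < card I"
  shows "\<exists>c. (\<exists>i\<in>I. c i \<noteq> 0) \<and> (\<forall>w\<in>W. (\<Sum>i\<in>I. c i * f w i) = 0)"
  using assms
proof (induction W arbitrary: I f rule: finite_induct)
  case empty
  then have "I \<noteq> {}" by auto
  then show ?case by (intro exI[of _ "\<lambda>_. 1"]) auto
next
  case (insert w W)
  show ?case
  proof (cases "\<forall>i\<in>I. f w i = 0")
    case True
    have "card W < card I" using insert by simp
    from insert.IH[OF insert.prems(1) this, of f] True show ?thesis by auto
  next
    case False
    then obtain j where j: "j \<in> I" "f w j \<noteq> 0" by blast
    \<comment> \<open>Subtracting a multiple of equation \<open>w\<close> eliminates the unknown
      \<open>j\<close>, since \<open>g u j = 0\<close>; its value is later recovered from equation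
      \<open>w\<close>.\<close>
    define g where "g u i = f u i - f u j * f w i / f w j" for u i
    have "card W < card (I - {j})" using insert j by simp
    from insert.IH[OF _ this, of g] insert.prems
    obtain c where c: "\<exists>i\<in>I - {j}. c i \<noteq> 0"
      and cW: "\<And>u. u \<in> W \<Longrightarrow> (\<Sum>i\<in>I - {j}. c i * g u i) = 0" by auto
    define s where "s = (\<Sum>i\<in>I - {j}. c i * f w i)"
    define d where "d = c(j := - s / f w j)"
    have split: "(\<Sum>i\<in>I. d i * f u i) = - s / f w j * f u j + (\<Sum>i\<in>I - {j}. c i * f u i)" for u
      using insert.prems j by (simp add: sum.remove[of I j] d_def)
    have "(\<Sum>i\<in>I. d i * f u i) = 0" if u: "u \<in> insert w W" for u
    proof (cases "u = w")
      case True
      then show ?thesis using split[of w] j by (simp add: s_def)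
    next
      case False
      then have "0 = (\<Sum>i\<in>I - {j}. c i * g u i)" using cW u by simp
      also have "\<dots> = (\<Sum>i\<in>I - {j}. c i * f u i) - f u j / f w j * s"
        by (simp add: g_def s_def right_diff_distrib sum_subtractf sum_distrib_left mult_ac)
      finally show ?thesis unfolding split by (simp add: mult.commute)
    qed
    moreover have "\<exists>i\<in>I. d i \<noteq> 0" using c by (auto simp: d_def)
    ultimately show ?thesis by blast
  qed
qed

section \<open>The Poincare--Miranda theorem on the Hilbert cube\<close>

definition hilbert_cube :: "(nat \<Rightarrow> real) set"
  where "hilbert_cube = {x. \<forall>i. x i \<in> {0..1}}"

lemma compact_hilbert_cube: "compact hilbert_cube"
proof -
  have "hilbert_cube = PiE UNIV (\<lambda>_. {0..1})"
    by (auto simp: hilbert_cube_def PiE_def)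
  moreover have "compactin (product_topology (\<lambda>_::nat. euclidean) UNIV) (PiE UNIV (\<lambda>_. {0..1::real}))"
    by (simp add: compactin_PiE)
  ultimately show ?thesis
    by (simp add: euclidean_product_topology compactin_euclidean_iff)
qed

lemma compact_hilbert_cube_slice: "compact {x \<in> hilbert_cube. x i = c}"
proof -
  have "closed {x :: nat \<Rightarrow> real. x i = c}"
    by (intro closed_Collect_eq continuous_intros continuous_on_product_coordinates)
  then have "compact (hilbert_cube \<inter> {x. x i = c})"
    by (intro compact_Int_closed compact_hilbert_cube)
  then show ?thesis by (simp add: Int_def)
qed

text \<open>
  The dimension \<open>n\<close> has to vary inside a proof, so it cannot be a type as in Brouwer's theorem of
  the library; Kuhn's combinatorial lemma, which is indexed by natural numbers, is used instead.
\<close>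

lemma poincare_miranda_approx:
  fixes g :: "(nat \<Rightarrow> real) \<Rightarrow> nat \<Rightarrow> real"
  assumes cont: "\<And>i. i < n \<Longrightarrow> continuous_on hilbert_cube (\<lambda>x. g x i)"
    and g0: "\<And>i x. i < n \<Longrightarrow> x \<in> hilbert_cube \<Longrightarrow> x i = 0 \<Longrightarrow> g x i \<le> 0"
    and g1: "\<And>i x. i < n \<Longrightarrow> x \<in> hilbert_cube \<Longrightarrow> x i = 1 \<Longrightarrow> g x i \<ge> 0"
    and "e > 0"
  shows "\<exists>x\<in>hilbert_cube. \<forall>i<n. \<bar>g x i\<bar> < e"
proof -
  have "\<exists>d>0. \<forall>x\<in>hilbert_cube. \<forall>y\<in>hilbert_cube. dist y x < d \<longrightarrow> dist (g y i) (g x i) < e" if "i < n" for i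
    using compact_uniformly_continuous[OF cont[OF that] compact_hilbert_cube] \<open>e > 0\<close>
    unfolding uniformly_continuous_on_def by blast
  then obtain d where d: "\<And>i. i < n \<Longrightarrow> d i > 0"
    and gd: "\<And>i x y. i < n \<Longrightarrow> x \<in> hilbert_cube \<Longrightarrow> y \<in> hilbert_cube \<Longrightarrow> dist y x < d i \<Longrightarrow> dist (g y i) (g x i) < e"
    by metis
  define D where "D = Min (insert 1 (d ` {..<n}))"
  have D: "D > 0" "\<And>i. i < n \<Longrightarrow> D \<le> d i"
    using d by (auto simp: D_def)
  \<comment> \<open>Mesh size \<open>1 / p\<close>: a coordinatewise error of one mesh costs at most
    twice that in the product metric.\<close>
  obtain p :: nat where p: "2 / D < real p"
    using reals_Archimedean2 by blast
  then have p0: "p > 0" using D(1) by (cases p) (auto simp: field_simps)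
  have pD: "2 * (1 / real p) < D" using p D(1) p0 by (simp add: field_simps)
  \<comment> \<open>The grid spans the first \<open>n\<close> directions and all other coordinates
    are 0, so a single infinite cube serves every dimension \<open>n\<close>.\<close>
  define pt :: "(nat \<Rightarrow> nat) \<Rightarrow> nat \<Rightarrow> real" where "pt k = (\<lambda>i. if i < n then real (k i) / real p else 0)" for k
  have pt: "pt k \<in> hilbert_cube" if "\<forall>i<n. k i \<le> p" for k
    using that p0 by (auto simp: pt_def hilbert_cube_def)
  \<comment> \<open>The label records the sign of \<open>g\<close>. On the two faces it is forced,
    as Kuhn's lemma requires, and \<open>g0\<close> and \<open>g1\<close> keep it compatible with
    the sign there.\<close>
  define label :: "(nat \<Rightarrow> nat) \<Rightarrow> nat \<Rightarrow> nat"
    where "label k i = (if k i = 0 then 0 else if k i = p then 1 else if g (pt k) i < 0 then 0 else 1)" for k i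
  have label_cases: "label k i = 0 \<and> g (pt k) i \<le> 0 \<or> label k i = 1 \<and> g (pt k) i \<ge> 0"
    if "\<forall>i<n. k i \<le> p" "i < n" for k i
    using g0[OF that(2) pt[OF that(1)]] g1[OF that(2) pt[OF that(1)]] that p0
    by (auto simp: label_def pt_def)
  obtain q where q: "\<forall>i<n. q i < p"
    and rs: "\<forall>i<n. \<exists>r s. (\<forall>j<n. q j \<le> r j \<and> r j \<le> q j + 1) \<and> (\<forall>j<n. q j \<le> s j \<and> s j \<le> q j + 1) \<and> label r i \<noteq> label s i"
    by (rule kuhn_lemma[of p n label]) (use p0 in \<open>auto simp: label_def\<close>)
  have qQ: "pt q \<in> hilbert_cube" using q by (intro pt) auto
  have near: "dist (g (pt r) i) (g (pt q) i) < e \<and> (\<forall>i<n. r i \<le> p)"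
    if r: "\<forall>j<n. q j \<le> r j \<and> r j \<le> q j + 1" and "i < n" for r i
  proof
    show rp: "\<forall>i<n. r i \<le> p" using r q by (metis Suc_eq_plus1 Suc_leI le_trans)
    have "dist (pt r j) (pt q j) \<le> 1 / real p" for j
    proof (cases "j < n")
      case True
      then have "\<bar>real (r j) - real (q j)\<bar> \<le> 1"
        using r[rule_format, of j] by linarith
      then show ?thesis
        using True by (simp add: pt_def dist_real_def divide_right_mono flip: diff_divide_distrib)
    qed (simp add: pt_def)
    then have "dist (pt r) (pt q) \<le> 2 * (1 / real p)" by (rule dist_fun_le)
    then have "dist (pt r) (pt q) < d i"
      using pD D(2)[OF \<open>i < n\<close>] by linarith
    then show "dist (g (pt r) i) (g (pt q) i) < e"
      using gd[OF \<open>i < n\<close> qQ pt[OF rp]] by blast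
  qed
  have "\<bar>g (pt q) i\<bar> < e" if i: "i < n" for i
  proof -
    obtain r s where "\<forall>j<n. q j \<le> r j \<and> r j \<le> q j + 1" "\<forall>j<n. q j \<le> s j \<and> s j \<le> q j + 1"
      and "label r i \<noteq> label s i"
      using rs i by blast
    \<comment> \<open>At one of the corners \<open>r\<close>, \<open>s\<close> the
      \<open>i\<close>-th component is at most 0, at the other at least 0, and both values are
      within \<open>e\<close> of the value at \<open>q\<close>.\<close>
    then show ?thesis
      using near[of r i] near[of s i] label_cases[of r i] label_cases[of s i] i
      unfolding dist_real_def by fastforce
  qed
  then show ?thesis using qQ by blast
qed

text \<open>By compactness the sum of the absolute values attains its minimum, and the approximate
  zeros push this minimum below every positive number.\<close>

lemma poincare_miranda:
  fixes g :: "(nat \<Rightarrow> real) \<Rightarrow> nat \<Rightarrow> real"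
  assumes cont: "\<And>i. i < n \<Longrightarrow> continuous_on hilbert_cube (\<lambda>x. g x i)"
    and g0: "\<And>i x. i < n \<Longrightarrow> x \<in> hilbert_cube \<Longrightarrow> x i = 0 \<Longrightarrow> g x i \<le> 0"
    and g1: "\<And>i x. i < n \<Longrightarrow> x \<in> hilbert_cube \<Longrightarrow> x i = 1 \<Longrightarrow> g x i \<ge> 0"
  shows "\<exists>x\<in>hilbert_cube. \<forall>i<n. g x i = 0"
proof -
  have "continuous_on hilbert_cube (\<lambda>x. \<Sum>i<n. \<bar>g x i\<bar>)"
    using cont by (intro continuous_intros) auto
  moreover have "hilbert_cube \<noteq> {}" by (auto simp: hilbert_cube_def intro: exI[of _ "\<lambda>_. 0"])
  ultimately obtain x where x: "x \<in> hilbert_cube"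
    and min: "\<And>y. y \<in> hilbert_cube \<Longrightarrow> (\<Sum>i<n. \<bar>g x i\<bar>) \<le> (\<Sum>i<n. \<bar>g y i\<bar>)"
    using continuous_attains_inf[OF compact_hilbert_cube] by metis
  have "(\<Sum>i<n. \<bar>g x i\<bar>) \<le> e" if e: "e > 0" for e
  proof -
    have "e / (real n + 1) > 0" using e by simp
    from poincare_miranda_approx[of n g, OF cont g0 g1 this]
    obtain y where y: "y \<in> hilbert_cube" and gy: "\<And>i. i < n \<Longrightarrow> \<bar>g y i\<bar> < e / (real n + 1)" by blast
    have "(\<Sum>i<n. \<bar>g y i\<bar>) \<le> real n * (e / (real n + 1))"
      using sum_bounded_above[of "{..<n}" "\<lambda>i. \<bar>g y i\<bar>" "e / (real n + 1)"] gy by force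
    also have "\<dots> \<le> e" using e by (simp add: field_simps)
    finally show ?thesis using min[OF y] by linarith
  qed
  then have "(\<Sum>i<n. \<bar>g x i\<bar>) \<le> 0" by (rule field_le_epsilon[of _ 0, simplified])
  then have "(\<Sum>i<n. \<bar>g x i\<bar>) = 0" by (simp add: antisym sum_nonneg)
  then have "\<forall>i<n. g x i = 0" by (simp add: sum_nonneg_eq_0_iff)
  then show ?thesis using x by blast
qed

text \<open>Each hyperplane meets the moment curve only at roots of a nonzero polynomial, and
  finitely many finite root sets cannot exhaust an interval.\<close>

lemma moment_curve_avoids_hyperplanes:
  fixes c :: "'a \<Rightarrow> nat \<Rightarrow> real"
  assumes "finite S" "\<And>s. s \<in> S \<Longrightarrow> \<exists>i\<le>n. c s i \<noteq> 0"
  shows "\<exists>t\<in>{0<..<1}. \<forall>s\<in>S. (\<Sum>i\<le>n. c s i * t ^ i) \<noteq> 0"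
proof -
  have "finite {t. (\<Sum>i\<le>n. c s i * t ^ i) = 0}" if "s \<in> S" for s
    using assms(2)[OF that] polyfun_rootbound by blast
  then have "finite (\<Union>s\<in>S. {t. (\<Sum>i\<le>n. c s i * t ^ i) = 0})"
    using assms(1) by blast
  moreover have "infinite {0<..<1::real}" by simp
  ultimately have "\<not> {0<..<1} \<subseteq> (\<Union>s\<in>S. {t. (\<Sum>i\<le>n. c s i * t ^ i) = 0})"
    using finite_subset by blast
  then show ?thesis by blast
qed

text \<open>
  A partition of unity subordinate to a cover of multiplicity at most \<open>n\<close> maps the cube into
  finitely many simplices of dimension less than \<open>n\<close> spanned by vertices of the cube. These all
  miss some point of the moment curve \<open>t \<mapsto> (t, t\<^sup>2, \<dots>, t\<^sup>n)\<close>, although the map preserves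
  the faces and hence attains every value by Poincare--Miranda.
\<close>

theorem lebesgue_covering:
  fixes \<C> :: "(nat \<Rightarrow> real) set set"
  assumes fin: "finite \<C>" and op: "\<And>U. U \<in> \<C> \<Longrightarrow> open U" and cov: "hilbert_cube \<subseteq> \<Union>\<C>"
    and faces: "\<And>U x y i. \<lbrakk>U \<in> \<C>; x \<in> U; y \<in> U; x \<in> hilbert_cube; y \<in> hilbert_cube; i < n; x i = 0\<rbrakk> \<Longrightarrow> y i \<noteq> 1"
  shows "\<exists>x\<in>hilbert_cube. n < card {U \<in> \<C>. x \<in> U}"
proof (rule ccontr)
  assume "\<not> ?thesis"
  then have mult: "card {U \<in> \<C>. x \<in> U} \<le> n" if "x \<in> hilbert_cube" for x
    using that by force
  obtain F :: "(nat \<Rightarrow> real) set \<Rightarrow> (nat \<Rightarrow> real) \<Rightarrow> real"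
    where contF: "\<And>U. U \<in> \<C> \<Longrightarrow> continuous_on hilbert_cube (F U)"
      and F0: "\<And>x U. \<lbrakk>U \<in> \<C>; x \<in> hilbert_cube; x \<notin> U\<rbrakk> \<Longrightarrow> F U x = 0"
      and F1: "\<And>x. x \<in> hilbert_cube \<Longrightarrow> supp_sum (\<lambda>W. F W x) \<C> = 1"
    by (rule subordinate_partition_of_unity[OF cov op])
      (use fin in \<open>auto intro: exI[of _ UNIV]\<close>)
  have F1': "(\<Sum>U\<in>\<C>. F U x) = 1" if "x \<in> hilbert_cube" for x
  proof -
    have "(\<Sum>U\<in>\<C>. F U x) = supp_sum (\<lambda>W. F W x) \<C>"
      unfolding supp_sum_def support_on_def
      by (rule sum.mono_neutral_right) (use fin in auto)
    then show ?thesis using F1[OF that] by simp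
  qed
  \<comment> \<open>\<open>v U\<close> is the vertex of the cube assigned to \<open>U\<close>. By
    \<open>faces\<close>, its coordinate \<open>i < n\<close> is 0 as soon as \<open>U\<close> meets
    the face \<open>x i = 0\<close> of the cube.\<close>
  define v :: "(nat \<Rightarrow> real) set \<Rightarrow> nat \<Rightarrow> real"
    where "v U i = (if \<exists>y\<in>U \<inter> hilbert_cube. y i = 1 then 1 else 0)" for U i
  \<comment> \<open>The leading coordinate 1 turns affine relations into linear ones:
    \<open>n + 1\<close> unknown coefficients against at most \<open>n\<close> equations.\<close>
  define v' where "v' U i = (case i of 0 \<Rightarrow> 1 | Suc j \<Rightarrow> v U j)" for U i
  define \<S> where "\<S> = {S. S \<subseteq> \<C> \<and> card S \<le> n}"
  have "\<exists>c. (\<exists>i\<le>n. c i \<noteq> 0) \<and> (\<forall>U\<in>S. (\<Sum>i\<le>n. c i * v' U i) = 0)" if "S \<in> \<S>" for S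
  proof -
    have "finite S" "card S < card {..n}" using that fin by (auto simp: \<S>_def finite_subset)
    then show ?thesis
      using homogeneous_system_nontrivial_solution[of S "{..n}" v'] by (simp add: Bex_def)
  qed
  then obtain c where c: "\<And>S. S \<in> \<S> \<Longrightarrow> \<exists>i\<le>n. c S i \<noteq> 0"
    and cv: "\<And>S U. S \<in> \<S> \<Longrightarrow> U \<in> S \<Longrightarrow> (\<Sum>i\<le>n. c S i * v' U i) = 0"
    by metis
  have "finite \<S>" using fin by (auto simp: \<S>_def)
  from moment_curve_avoids_hyperplanes[OF this c]
  obtain t where t: "0 < t" "t < 1" and tS: "\<And>S. S \<in> \<S> \<Longrightarrow> (\<Sum>i\<le>n. c S i * t ^ i) \<noteq> 0"
    by force
  \<comment> \<open>A common zero of the first \<open>n\<close> components is a point that the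
    partition of unity maps to the chosen point of the moment curve.\<close>
  define g where "g x i = (\<Sum>U\<in>\<C>. F U x * v U i) - t ^ Suc i" for x i
  have "\<exists>x\<in>hilbert_cube. \<forall>i<n. g x i = 0"
  proof (rule poincare_miranda)
    show "continuous_on hilbert_cube (\<lambda>x. g x i)" for i
      unfolding g_def by (intro continuous_intros contF) auto
    show "g x i \<le> 0" if i: "i < n" and x: "x \<in> hilbert_cube" "x i = 0" for i x
    proof -
      have "F U x * v U i = 0" if "U \<in> \<C>" for U
        using F0[OF that x(1)] faces[OF that _ _ x(1) _ i x(2)] by (auto simp: v_def)
      then have "(\<Sum>U\<in>\<C>. F U x * v U i) = 0" by (rule sum.neutral[rule_format])
      then show ?thesis using t by (simp add: g_def)
    qed
    show "g x i \<ge> 0" if i: "i < n" and x: "x \<in> hilbert_cube" "x i = 1" for i x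
    proof -
      have "F U x * v U i = F U x" if "U \<in> \<C>" for U
        using F0[OF that x(1)] x by (auto simp: v_def)
      then have "(\<Sum>U\<in>\<C>. F U x * v U i) = (\<Sum>U\<in>\<C>. F U x)"
        by (rule sum.cong[OF HOL.refl])
      then have "g x i = 1 - t ^ Suc i" using F1'[OF x(1)] by (simp add: g_def)
      then show ?thesis using power_le_one[of t "Suc i"] t by simp
    qed
  qed
  then obtain x where x: "x \<in> hilbert_cube" and gx: "\<And>i. i < n \<Longrightarrow> g x i = 0" by blast
  define S where "S = {U \<in> \<C>. x \<in> U}"
  have S: "S \<in> \<S>" using mult[OF x] by (auto simp: \<S>_def S_def)
  have tv: "t ^ i = (\<Sum>U\<in>\<C>. F U x * v' U i)" if "i \<le> n" for i
    using F1'[OF x] gx[of "i - 1"] that by (cases i) (auto simp: v'_def g_def)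
  \<comment> \<open>Evaluate the hyperplane through the vertices of the sets containing
    \<open>x\<close>: it vanishes at those vertices, and the other sets have weight 0.\<close>
  have "(\<Sum>i\<le>n. c S i * t ^ i) = (\<Sum>i\<le>n. \<Sum>U\<in>\<C>. F U x * (c S i * v' U i))"
    by (simp add: tv sum_distrib_left mult_ac)
  also have "\<dots> = (\<Sum>U\<in>\<C>. F U x * (\<Sum>i\<le>n. c S i * v' U i))"
    by (subst sum.swap) (simp add: sum_distrib_left)
  also have "\<dots> = 0"
    using cv[OF S] F0[OF _ x] by (intro sum.neutral) (auto simp: S_def)
  finally show False using tS[OF S] by simp
qed

section \<open>Homogeneous quasimetric spaces\<close>

locale quasimetric_space =
  fixes X :: "'a set" and \<rho> :: "'a \<Rightarrow> 'a \<Rightarrow> real" and K :: real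
  assumes K: "K \<ge> 1"
    and nonneg: "\<And>x y. x \<in> X \<Longrightarrow> y \<in> X \<Longrightarrow> 0 \<le> \<rho> x y"
    and zero_iff: "\<And>x y. x \<in> X \<Longrightarrow> y \<in> X \<Longrightarrow> \<rho> x y = 0 \<longleftrightarrow> x = y"
    and sym: "\<And>x y. x \<in> X \<Longrightarrow> y \<in> X \<Longrightarrow> \<rho> x y = \<rho> y x"
    and triangle: "\<And>x y z. x \<in> X \<Longrightarrow> y \<in> X \<Longrightarrow> z \<in> X \<Longrightarrow> \<rho> x y \<le> K * (\<rho> x z + \<rho> z y)"
begin

abbreviation B where "B \<equiv> qball X \<rho>"
abbreviation T where "T \<equiv> quasimetric_topology X \<rho>"

lemma refl: "x \<in> X \<Longrightarrow> \<rho> x x = 0"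
  by (simp add: zero_iff)

lemma triangle_le:
  assumes "x \<in> X" "y \<in> X" "z \<in> X" "\<rho> x z \<le> a" "\<rho> z y \<le> b"
  shows "\<rho> x y \<le> K * (a + b)"
proof -
  have "K * (\<rho> x z + \<rho> z y) \<le> K * (a + b)"
    using K assms by (intro mult_left_mono) auto
  then show ?thesis using triangle[OF assms(1-3)] by linarith
qed

lemma triangle_less:
  assumes "x \<in> X" "y \<in> X" "z \<in> X" "\<rho> x z \<le> a" "\<rho> z y < b"
  shows "\<rho> x y < K * (a + b)"
proof -
  have "K * (\<rho> x z + \<rho> z y) < K * (a + b)"
    using K assms by (intro mult_strict_left_mono) auto
  then show ?thesis using triangle[OF assms(1-3)] by linarith
qed

text \<open>
  Balls need not be open. The points reachable from \<open>x\<close> by finite chains whose step lengths are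
  bounded by \<open>s, s / (2 * K), s / (2 * K)\<^sup>2, \<dots>\<close> do form an open set, and the decay of the step
  lengths keeps them within distance \<open>2 * K * s\<close> of \<open>x\<close>.
\<close>

primrec chains :: "nat \<Rightarrow> real \<Rightarrow> 'a \<Rightarrow> 'a set" where
  "chains 0 s x = {x}"
| "chains (Suc n) s x = (\<Union>y\<in>B x s. chains n (s / (2 * K)) y)"

text \<open>After a first step shorter than \<open>s\<close>, the induction hypothesis bounds the
  remainder by \<open>2 * K * (s / (2 * K)) = s\<close>, and
  \<open>K * (s + s) = 2 * K * s\<close>.\<close>

lemma chains_bounded:
  assumes "x \<in> X" "s > 0" "y \<in> chains n s x"
  shows "y \<in> X \<and> \<rho> x y \<le> 2 * K * s"
  using assms
proof (induction n arbitrary: x s)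
  case 0
  then show ?case using K refl by simp
next
  case (Suc n)
  then obtain z where z: "z \<in> X" "\<rho> x z < s" "y \<in> chains n (s / (2 * K)) z"
    by (auto simp: qball_def)
  have "y \<in> X \<and> \<rho> z y \<le> 2 * K * (s / (2 * K))"
    using Suc.IH[OF z(1) _ z(3)] Suc.prems K by simp
  then show ?case
    using triangle_le[of x y z s s] z Suc.prems K by simp
qed

text \<open>Chains grow at the front by definition, whereas openness needs a further step at the
  end.\<close>

lemma chains_step:
  assumes "y \<in> chains n s x"
  shows "B y (s / (2 * K) ^ n) \<subseteq> chains (Suc n) s x"
  using assms
proof (induction n arbitrary: x s)
  case (Suc n)
  then obtain z where z: "z \<in> B x s" "y \<in> chains n (s / (2 * K)) z" by auto
  have "B y (s / (2 * K) / (2 * K) ^ n) \<subseteq> chains (Suc n) (s / (2 * K)) z"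
    by (rule Suc.IH[OF z(2)])
  also have "\<dots> \<subseteq> chains (Suc (Suc n)) s x" using z(1)
    by (auto simp del: chains.simps(2) simp: chains.simps(2)[of "Suc n"])
  finally show ?case by simp
qed auto

text \<open>This open set replaces the ball wherever openness is needed, at the price of a factor
  \<open>2 * K\<close> in the radius.\<close>

lemma ball_subset_open:
  assumes x: "x \<in> X" and "r > 0"
  obtains U where "openin T U" "B x r \<subseteq> U" "\<And>y. y \<in> U \<Longrightarrow> y \<in> X \<and> \<rho> x y \<le> 2 * K * r"
proof
  let ?U = "\<Union>n. chains n r x"
  show bd: "y \<in> X \<and> \<rho> x y \<le> 2 * K * r" if "y \<in> ?U" for y
    using that chains_bounded[OF assms] by blast
  have "B x r \<subseteq> chains (Suc 0) r x" by auto
  then show "B x r \<subseteq> ?U" by blast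
  have "\<exists>s>0. B y s \<subseteq> ?U" if yU: "y \<in> ?U" for y
  proof -
    obtain n where "y \<in> chains n r x" using yU by auto
    then have "B y (r / (2 * K) ^ n) \<subseteq> ?U" using chains_step by blast
    moreover have "r / (2 * K) ^ n > 0" using K \<open>r > 0\<close> by simp
    ultimately show ?thesis by blast
  qed
  then show "openin T ?U" using bd by (auto simp: openin_quasimetric_topology)
qed

lemma center_in_ball: "x \<in> X \<Longrightarrow> r > 0 \<Longrightarrow> x \<in> B x r"
  by (simp add: qball_def refl)

lemma Hausdorff_space_quasimetric: "Hausdorff_space T"
  unfolding Hausdorff_space_def topspace_quasimetric_topology
proof (intro allI impI)
  fix x y assume xy: "x \<in> X \<and> y \<in> X \<and> x \<noteq> y"
  \<comment> \<open>If the enlarged neighbourhoods met, the distance would be at most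
    \<open>4 * K * K * r\<close>; the 5 makes this smaller than \<open>\<rho> x y\<close>.\<close>
  define r where "r = \<rho> x y / (5 * K * K)"
  have "\<rho> x y > 0" using xy nonneg[of x y] zero_iff[of x y] by linarith
  then have r: "r > 0" "K * (2 * K * r + 2 * K * r) < \<rho> x y"
    using K by (simp_all add: r_def field_simps)
  obtain U where U: "openin T U" "B x r \<subseteq> U" "\<And>z. z \<in> U \<Longrightarrow> z \<in> X \<and> \<rho> x z \<le> 2 * K * r"
    using ball_subset_open[of x r] xy r by blast
  obtain V where V: "openin T V" "B y r \<subseteq> V" "\<And>z. z \<in> V \<Longrightarrow> z \<in> X \<and> \<rho> y z \<le> 2 * K * r"
    using ball_subset_open[of y r] xy r by blast
  have "disjnt U V"
    unfolding disjnt_iff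
  proof (intro allI notI)
    fix z assume z: "z \<in> U \<and> z \<in> V"
    then have "z \<in> X" "\<rho> x z \<le> 2 * K * r" "\<rho> z y \<le> 2 * K * r"
      using U(3)[of z] V(3)[of z] sym[of y z] xy by simp_all
    then have "\<rho> x y \<le> K * (2 * K * r + 2 * K * r)"
      using xy by (intro triangle_le[of x y z]) auto
    then show False using r by simp
  qed
  moreover have "x \<in> U" "y \<in> V"
    using U(2) V(2) center_in_ball[of _ r] xy r(1) by auto
  ultimately show "\<exists>U V. openin T U \<and> openin T V \<and> x \<in> U \<and> y \<in> V \<and> disjnt U V"
    using U(1) V(1) by (intro exI conjI)
qed

section \<open>Compact sets in the quasimetric topology\<close>

lemma compactin_bounded:
  assumes "compactin T C" and x: "x \<in> X"
  shows "\<exists>R>0. C \<subseteq> B x R"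
proof -
  \<comment> \<open>Balls cannot serve as an open cover themselves, so each is enclosed in an open
    set of comparable size.\<close>
  have "\<exists>U. openin T U \<and> B x (real (Suc k)) \<subseteq> U \<and> (\<forall>y\<in>U. \<rho> x y \<le> 2 * K * real (Suc k))" for k
    by (rule ball_subset_open[OF x, of "real (Suc k)"]) auto
  then obtain U where U: "\<And>k. openin T (U k)" "\<And>k. B x (real (Suc k)) \<subseteq> U k"
    and bd: "\<And>k y. y \<in> U k \<Longrightarrow> \<rho> x y \<le> 2 * K * real (Suc k)"
    by metis
  have CX: "C \<subseteq> X"
    using compactin_subset_topspace[OF assms(1)] by (simp add: topspace_quasimetric_topology)
  have "C \<subseteq> \<Union>(range U)"
  proof
    fix y assume "y \<in> C"
    moreover obtain k where "\<rho> x y < real k" using reals_Archimedean2 by blast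
    ultimately have "y \<in> B x (real (Suc k))" using CX by (auto simp: qball_def)
    then show "y \<in> \<Union>(range U)" using U by blast
  qed
  then obtain \<F> where \<F>: "finite \<F>" "\<F> \<subseteq> range U" "C \<subseteq> \<Union>\<F>"
    using assms(1) U(1) unfolding compactin_def by (metis imageE)
  then obtain I where I: "finite I" "\<F> = U ` I" by (metis finite_subset_image)
  define R where "R = 2 * K * real (Suc (Max (insert 0 I))) + 1"
  have "C \<subseteq> B x R"
  proof
    fix y assume y: "y \<in> C"
    then obtain k where k: "k \<in> I" "y \<in> U k" using \<F> I by blast
    have "k \<le> Max (insert 0 I)" using I k by simp
    then have "2 * K * real (Suc k) \<le> 2 * K * real (Suc (Max (insert 0 I)))"
      using K by (intro mult_left_mono) auto
    then show "y \<in> B x R" using bd[OF k(2)] y CX by (auto simp: qball_def R_def)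
  qed
  moreover have "R > 0" using K by (simp add: R_def add_nonneg_pos)
  ultimately show ?thesis by blast
qed

text \<open>A Lebesgue number argument: every point of \<open>C\<close> has a neighbourhood on which
  one radius works, and finitely many of these cover \<open>C\<close>.\<close>

lemma compactin_uniform_neighbourhood:
  assumes C: "compactin T C" and G: "openin T G" and "C \<subseteq> G"
  shows "\<exists>d>0. \<forall>y\<in>C. B y d \<subseteq> G"
proof -
  have CX: "C \<subseteq> X"
    using compactin_subset_topspace[OF C] by (simp add: topspace_quasimetric_topology)
  have "\<exists>U s. openin T U \<and> s > 0 \<and> y \<in> U \<and> (\<forall>z\<in>U. B z s \<subseteq> G)" if y: "y \<in> C" for y
  proof -
    obtain r where r: "r > 0" "B y r \<subseteq> G"
      using G y \<open>C \<subseteq> G\<close> unfolding openin_quasimetric_topology by blast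
    \<comment> \<open>The radius \<open>s\<close> solves \<open>K * (2 * K * s + s) = r\<close>: a
      point of \<open>U\<close> is within \<open>2 * K * s\<close> of \<open>y\<close>, and a
      further step shorter than \<open>s\<close> stays in \<open>B y r\<close>.\<close>
    define P where "P = K * (2 * K + 1)"
    define s where "s = r / P"
    have "P > 0" using K by (simp add: P_def)
    moreover have "K * (2 * K * s + s) = P * s" by (simp add: P_def algebra_simps)
    ultimately have s: "s > 0" "K * (2 * K * s + s) = r" using r by (simp_all add: s_def)
    obtain U where U: "openin T U" "B y s \<subseteq> U" "\<And>z. z \<in> U \<Longrightarrow> z \<in> X \<and> \<rho> y z \<le> 2 * K * s"
      using ball_subset_open[of y s] y CX s by blast
    have "B z s \<subseteq> G" if "z \<in> U" for z
    proof
      fix w assume "w \<in> B z s"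
      then have "w \<in> X" "\<rho> y w < r"
        using triangle_less[of y w z "2 * K * s" s] U(3)[OF that] s y CX by (auto simp: qball_def)
      then show "w \<in> G" using r by (auto simp: qball_def)
    qed
    moreover have "y \<in> U" using U center_in_ball[of y s] y CX s by blast
    ultimately show ?thesis using U(1) s(1) by blast
  qed
  then obtain U s where U: "\<And>y. y \<in> C \<Longrightarrow> openin T (U y)" "\<And>y. y \<in> C \<Longrightarrow> s y > (0::real)"
      "\<And>y. y \<in> C \<Longrightarrow> y \<in> U y" and UG: "\<And>y z. y \<in> C \<Longrightarrow> z \<in> U y \<Longrightarrow> B z (s y) \<subseteq> G"
    by metis
  have "(\<forall>V\<in>U ` C. openin T V) \<and> C \<subseteq> \<Union>(U ` C)" using U by auto
  then obtain \<F> where \<F>: "finite \<F>" "\<F> \<subseteq> U ` C" "C \<subseteq> \<Union>\<F>"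
    using C unfolding compactin_def by meson
  then obtain I where I: "finite I" "I \<subseteq> C" "\<F> = U ` I" by (metis finite_subset_image)
  define d where "d = Min (insert 1 (s ` I))"
  have "d > 0" using I U(2) by (auto simp: d_def)
  moreover have "B y d \<subseteq> G" if "y \<in> C" for y
  proof -
    obtain z where z: "z \<in> I" "y \<in> U z" using \<F> I \<open>y \<in> C\<close> by blast
    then have "d \<le> s z" using I by (simp add: d_def)
    then have "B y d \<subseteq> B y (s z)" by (auto simp: qball_def)
    then show ?thesis using UG[of z y] z I by blast
  qed
  ultimately show ?thesis by blast
qed

section \<open>Doubling and the size of separated sets\<close>

definition separated :: "real \<Rightarrow> 'a set \<Rightarrow> bool"
  where "separated r S \<longleftrightarrow> (\<forall>a\<in>S. \<forall>b\<in>S. a \<noteq> b \<longrightarrow> r \<le> \<rho> a b)"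

text \<open>Packing: small balls about the points of \<open>S\<close> are disjoint, lie in one ball
  \<open>B x R\<close>, and each carries at least a fixed fraction of its measure. What matters
  later is that \<open>N\<close> is independent of \<open>r\<close>.\<close>

lemma homogeneous_imp_doubling:
  assumes "coifman_weiss_homogeneous X \<rho> \<mu>"
  shows "\<exists>N. \<forall>x\<in>X. \<forall>r>0. \<forall>S. finite S \<and> S \<subseteq> B x (c * r) \<and> separated r S \<longrightarrow> card S \<le> N"
proof -
  let ?\<mu> = "emeasure (completion \<mu>)"
  note emeasure_completion [simp del]
  have meas: "B x r \<in> sets (completion \<mu>)" if "x \<in> X" "r > 0" for x r
    using assms that by (simp add: coifman_weiss_homogeneous_def)
  have pos: "?\<mu> (B x r) > 0" "?\<mu> (B x r) < \<infinity>" if "x \<in> X" "r > 0" for x r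
    using assms that unfolding coifman_weiss_homogeneous_def by blast+
  obtain C :: real where C: "C \<ge> 1"
    and dbl: "\<And>x r. x \<in> X \<Longrightarrow> r > 0 \<Longrightarrow> ?\<mu> (B x (2 * r)) \<le> ennreal C * ?\<mu> (B x r)"
    using assms unfolding coifman_weiss_homogeneous_def by blast
  have iter: "?\<mu> (B x (2 ^ m * r)) \<le> ennreal (C ^ m) * ?\<mu> (B x r)" if "x \<in> X" "r > 0" for x r m
  proof (induction m)
    case (Suc m)
    have "?\<mu> (B x (2 ^ Suc m * r)) \<le> ennreal C * ?\<mu> (B x (2 ^ m * r))"
      using dbl[OF that(1), of "2 ^ m * r"] that by (simp add: mult.assoc)
    also have "\<dots> \<le> ennreal C * (ennreal (C ^ m) * ?\<mu> (B x r))"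
      using Suc by (rule mult_left_mono) simp
    also have "\<dots> = ennreal (C ^ Suc m) * ?\<mu> (B x r)"
      using C by (simp add: ennreal_mult mult.assoc)
    finally show ?case .
  qed simp
  \<comment> \<open>In units of \<open>t = r / (2 * K)\<close>, the radius at which a ball about any
    point of \<open>S\<close> contains \<open>B x R\<close>.\<close>
  define b where "b = 2 * K * (K * (c + K * (c + 1)))"
  obtain m where m: "b < 2 ^ m" using real_arch_pow[of 2 b] by auto
  have "card S \<le> nat \<lfloor>C ^ m\<rfloor>"
    if x: "x \<in> X" and r: "r > 0" and S: "finite S" "S \<subseteq> B x (c * r)" "separated r S" for x r S
  proof (cases "S = {}")
    case False
    define t where "t = r / (2 * K)"
    define R where "R = K * (c * r + r)"
    have t: "t > 0" "t \<le> r" "K * (t + t) = r" using r K by (auto simp: t_def field_simps)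
    have SX: "a \<in> X" "\<rho> x a < c * r" if "a \<in> S" for a using S(2) that by (auto simp: qball_def)
    have "c * r > 0" using False SX nonneg[OF x] by fastforce
    then have R: "R > 0" using K r by (simp add: R_def)
    have sub: "B a t \<subseteq> B x R" if "a \<in> S" for a
    proof
      fix y assume y: "y \<in> B a t"
      then show "y \<in> B x R"
        using triangle_less[of x y a "c * r" r] SX[OF that] x t by (auto simp: qball_def R_def)
    qed
    have sup: "B x R \<subseteq> B a (2 ^ m * t)" if "a \<in> S" for a
    proof
      fix y assume y: "y \<in> B x R"
      have "\<rho> a y < K * (c * r + R)"
        using triangle_less[of a y x "c * r" R] SX[OF that] sym[of a x] x y by (auto simp: qball_def)
      also have "\<dots> = b * t" using K by (simp add: R_def b_def t_def field_simps)
      also have "\<dots> \<le> 2 ^ m * t" using m t by (intro mult_right_mono) auto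
      finally show "y \<in> B a (2 ^ m * t)" using y by (simp add: qball_def)
    qed
    have disj: "disjoint_family_on (\<lambda>a. B a t) S"
      unfolding disjoint_family_on_def
    proof (intro ballI impI equals0I)
      fix a a' y assume a: "a \<in> S" "a' \<in> S" "a \<noteq> a'" and "y \<in> B a t \<inter> B a' t"
      then have "\<rho> a a' < r"
        using triangle_less[of a a' y t t] SX sym[of a' y] t(3) by (auto simp: qball_def)
      then show False using S(3) a by (force simp: separated_def)
    qed
    have "of_nat (card S) * ?\<mu> (B x R) = (\<Sum>a\<in>S. ?\<mu> (B x R))" by simp
    also have "\<dots> \<le> (\<Sum>a\<in>S. ennreal (C ^ m) * ?\<mu> (B a t))"
    proof (rule sum_mono)
      fix a assume a: "a \<in> S"
      have "?\<mu> (B x R) \<le> ?\<mu> (B a (2 ^ m * t))"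
        using sup[OF a] meas SX[OF a] t by (intro emeasure_mono) auto
      then show "?\<mu> (B x R) \<le> ennreal (C ^ m) * ?\<mu> (B a t)"
        using iter[OF SX(1)[OF a] t(1)] order_trans by blast
    qed
    also have "\<dots> = ennreal (C ^ m) * ?\<mu> (\<Union>a\<in>S. B a t)"
      using meas SX t S(1) disj by (subst sum_emeasure[symmetric]) (auto simp: sum_distrib_left)
    also have "\<dots> \<le> ennreal (C ^ m) * ?\<mu> (B x R)"
      using sub meas x R by (intro mult_left_mono emeasure_mono) auto
    \<comment> \<open>The measure of \<open>B x R\<close> is positive and finite, so it
      cancels.\<close>
    finally have "of_nat (card S) \<le> ennreal (C ^ m)"
      using pos[OF x R] by (simp add: mult.commute[of _ "?\<mu> (B x R)"] ennreal_mult_le_mult_iff)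
    then have "real (card S) \<le> C ^ m"
      using C by (simp add: ennreal_of_nat_eq_real_of_nat)
    then show ?thesis by (simp add: le_nat_floor)
  qed simp
  then show ?thesis by blast
qed

text \<open>Doubling bounds the size of separated subsets of the bounded set \<open>C\<close>. To
  one of largest size no point at distance at least \<open>r\<close> from all its members can be
  added.\<close>

lemma exists_maximal_separated:
  assumes "coifman_weiss_homogeneous X \<rho> \<mu>" "compactin T C" "r > 0"
  shows "\<exists>A. finite A \<and> A \<subseteq> C \<and> separated r A \<and> C \<subseteq> (\<Union>a\<in>A. B a r)"
proof (cases "C = {}")
  case False
  have CX: "C \<subseteq> X"
    using compactin_subset_topspace[OF assms(2)] by (simp add: topspace_quasimetric_topology)
  then obtain x where x: "x \<in> X" using False by blast
  obtain R where R: "C \<subseteq> B x R" using compactin_bounded[OF assms(2) x] by blast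
  obtain N where "\<forall>x\<in>X. \<forall>r'>0. \<forall>S. finite S \<and> S \<subseteq> B x (R / r * r') \<and> separated r' S \<longrightarrow> card S \<le> N"
    using homogeneous_imp_doubling[OF assms(1), of "R / r"] by (elim exE)
  from this[rule_format, OF x \<open>r > 0\<close>]
  have N: "card S \<le> N" if "finite S" "S \<subseteq> B x R" "separated r S" for S
    using that \<open>r > 0\<close> by simp
  let ?P = "\<lambda>S. finite S \<and> S \<subseteq> C \<and> separated r S"
  have "?P {}" by (simp add: separated_def)
  moreover have "\<forall>S. ?P S \<longrightarrow> card S < Suc N" using N R by (metis less_Suc_eq_le subset_trans)
  ultimately obtain A where A: "?P A" and max: "\<And>S. ?P S \<Longrightarrow> card S \<le> card A"
    using ex_has_greatest_nat[of ?P "{}" card "Suc N"] by blast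
  have "y \<in> (\<Union>a\<in>A. B a r)" if y: "y \<in> C" for y
  proof (rule ccontr)
    assume "y \<notin> (\<Union>a\<in>A. B a r)"
    then have far: "r \<le> \<rho> a y" "r \<le> \<rho> y a" if "a \<in> A" for a
      using that y CX A sym[of a y] by (force simp: qball_def)+
    then have "y \<notin> A" using refl[of y] y CX \<open>r > 0\<close> by force
    moreover have "?P (insert y A)" using A y far by (auto simp: separated_def)
    ultimately show False using max[of "insert y A"] A by simp
  qed
  then show ?thesis using A by blast
qed (auto simp: separated_def)

text \<open>The order of choices matters: the multiplicity bound \<open>n\<close> comes first, and
  only then is the scale \<open>r\<close> made small enough to separate the first \<open>n\<close>
  pairs of opposite faces.\<close>

theorem homogeneous_not_contains_hilbert_cube:
  assumes hom: "coifman_weiss_homogeneous X \<rho> \<mu>"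
    and cont: "continuous_map (top_of_set hilbert_cube) T e"
    and inj: "inj_on e hilbert_cube"
  shows False
proof -
  have compact_image: "compactin T (e ` C)" if "compact C" "C \<subseteq> hilbert_cube" for C
    using image_compactin[OF _ cont, of C] that by (simp add: compactin_subtopology)
  have eX: "e x \<in> X" if "x \<in> hilbert_cube" for x
    using continuous_map_image_subset_topspace[OF cont] that
    by (auto simp: topspace_quasimetric_topology)
  define face where "face i c = {x \<in> hilbert_cube. x i = (c :: real)}" for i c
  have face: "compact (face i c)" "face i c \<subseteq> hilbert_cube" for i c
    by (auto simp: face_def compact_hilbert_cube_slice)
  \<comment> \<open>The factor \<open>2 * K + 1\<close> puts all centres \<open>a\<close> with
    \<open>e x\<close> in \<open>U a\<close>, which are within \<open>2 * K * r\<close> of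
    \<open>e x\<close>, into an open-ended ball about \<open>e x\<close>.\<close>
  obtain n where n: "\<And>x r S. x \<in> X \<Longrightarrow> r > 0 \<Longrightarrow> finite S \<and> S \<subseteq> B x ((2 * K + 1) * r) \<and> separated r S \<Longrightarrow> card S \<le> n"
    using homogeneous_imp_doubling[OF hom, of "2 * K + 1"] by meson
  have "\<exists>d>0. \<forall>y\<in>e ` face i 0. B y d \<subseteq> X - e ` face i 1" for i
  proof (rule compactin_uniform_neighbourhood)
    show "compactin T (e ` face i 0)"
      by (intro compact_image face)
    have "closedin T (e ` face i 1)"
      by (intro compactin_imp_closedin Hausdorff_space_quasimetric compact_image face)
    then show "openin T (X - e ` face i 1)"
      by (simp add: closedin_def topspace_quasimetric_topology)
    have "e x \<notin> e ` face i 1" if x: "x \<in> face i 0" for x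
    proof
      assume "e x \<in> e ` face i 1"
      then obtain y where y: "y \<in> face i 1" "e x = e y" by (rule imageE)
      have "x = y" by (rule inj_onD[OF inj, OF y(2)]) (use x y(1) in \<open>simp_all add: face_def\<close>)
      then show False using x y(1) by (simp add: face_def)
    qed
    then show "e ` face i 0 \<subseteq> X - e ` face i 1"
      by (intro image_subsetI DiffI eX) (auto simp: face_def)
  qed
  then obtain d where d: "\<And>i. d i > 0"
    and faces: "\<And>i y. y \<in> e ` face i 0 \<Longrightarrow> B y (d i) \<subseteq> X - e ` face i 1"
    by metis
  define D where "D = Min (insert 1 (d ` {..<n}))"
  have D: "D > 0" "\<And>i. i < n \<Longrightarrow> D \<le> d i" using d by (auto simp: D_def)
  \<comment> \<open>Two points of the same \<open>U a\<close> are at most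
    \<open>4 * K * K * r < D\<close> apart, so no \<open>U a\<close> meets the images of two
    opposite faces in the first \<open>n\<close> directions.\<close>
  define r where "r = D / (5 * K * K)"
  have r: "r > 0" "K * (2 * K * r + 2 * K * r) < D"
    using D(1) K by (simp_all add: r_def field_simps)
  from exists_maximal_separated[OF hom compact_image[OF compact_hilbert_cube] r(1)]
  obtain A where A: "finite A" "A \<subseteq> e ` hilbert_cube" "separated r A"
    and cov: "e ` hilbert_cube \<subseteq> (\<Union>a\<in>A. B a r)"
    by blast
  have AX: "a \<in> X" if "a \<in> A" for a using that A(2) eX by blast
  have "\<exists>U. openin T U \<and> B a r \<subseteq> U \<and> (\<forall>y\<in>U. \<rho> a y \<le> 2 * K * r)" if "a \<in> A" for a
    using ball_subset_open[OF AX[OF that] r(1)] by metis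
  then obtain U where U: "\<And>a. a \<in> A \<Longrightarrow> openin T (U a)" "\<And>a. a \<in> A \<Longrightarrow> B a r \<subseteq> U a"
    and bd: "\<And>a y. a \<in> A \<Longrightarrow> y \<in> U a \<Longrightarrow> \<rho> a y \<le> 2 * K * r"
    by metis
  have "\<exists>V. open V \<and> {x \<in> hilbert_cube. e x \<in> U a} = hilbert_cube \<inter> V" if "a \<in> A" for a
    using openin_continuous_map_preimage[OF cont U(1)[OF that]] by (simp add: openin_open)
  then obtain V where V: "\<And>a. a \<in> A \<Longrightarrow> open (V a)"
    and "\<And>a. a \<in> A \<Longrightarrow> {x \<in> hilbert_cube. e x \<in> U a} = hilbert_cube \<inter> V a"
    by metis
  then have VU: "x \<in> V a \<longleftrightarrow> e x \<in> U a" if "a \<in> A" "x \<in> hilbert_cube" for a x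
    using that by blast
  have "\<exists>x\<in>hilbert_cube. n < card {W \<in> V ` A. x \<in> W}"
  proof (rule lebesgue_covering)
    show "finite (V ` A)" using A by simp
    show "open W" if "W \<in> V ` A" for W
      using that V by blast
    show "hilbert_cube \<subseteq> \<Union>(V ` A)"
    proof
      fix x assume x: "x \<in> hilbert_cube"
      then obtain a where "a \<in> A" "e x \<in> B a r" using cov by blast
      then show "x \<in> \<Union>(V ` A)" using U(2) VU x by blast
    qed
    show "y i \<noteq> 1"
      if W: "W \<in> V ` A" "x \<in> W" "y \<in> W" and x: "x \<in> hilbert_cube" and y: "y \<in> hilbert_cube"
        and i: "i < n" and x0: "x i = 0" for W x y i
    proof
      assume y1: "y i = 1"
      obtain a where a: "a \<in> A" "e x \<in> U a" "e y \<in> U a" using W VU x y by blast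
      have "\<rho> (e x) a \<le> 2 * K * r" "\<rho> a (e y) \<le> 2 * K * r"
        using bd[OF a(1,2)] bd[OF a(1,3)] sym[OF eX[OF x] AX[OF a(1)]] by simp_all
      then have "\<rho> (e x) (e y) \<le> K * (2 * K * r + 2 * K * r)"
        by (intro triangle_le[OF eX[OF x] eX[OF y] AX[OF a(1)]])
      then have "e y \<in> B (e x) (d i)" using r(2) D(2)[OF i] eX[OF y] by (simp add: qball_def)
      then have "e y \<notin> e ` face i 1" using faces[of "e x" i] x x0 by (auto simp: face_def)
      then show False using y y1 by (simp add: face_def)
    qed
  qed
  then obtain x where x: "x \<in> hilbert_cube" "n < card {W \<in> V ` A. x \<in> W}" by blast
  define S where "S = {a \<in> A. e x \<in> U a}"
  \<comment> \<open>Different centres may give the same set \<open>V a\<close>; this can only make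
    the cover's multiplicity smaller than \<open>card S\<close>.\<close>
  have "{W \<in> V ` A. x \<in> W} = V ` S" using VU x(1) by (auto simp: S_def)
  then have "n < card S"
    using x(2) card_image_le[of S V] A(1) by (simp add: S_def)
  moreover have "S \<subseteq> B (e x) ((2 * K + 1) * r)"
  proof
    fix a assume a: "a \<in> S"
    then have "a \<in> X" "\<rho> (e x) a \<le> 2 * K * r"
      using bd[of a "e x"] sym[OF eX[OF x(1)] AX[of a]] AX by (auto simp: S_def)
    then show "a \<in> B (e x) ((2 * K + 1) * r)"
      using r(1) by (simp add: qball_def algebra_simps)
  qed
  moreover have "separated r S" "finite S" using A by (auto simp: separated_def S_def)
  ultimately show False using n[OF eX[OF x(1)] r(1), of S] by linarith
qed

end

lemma quasimetric_imp_quasimetric_space: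
  assumes "quasimetric X \<rho>"
  shows "\<exists>K. quasimetric_space X \<rho> K"
proof -
  have "\<exists>K\<ge>1. \<forall>x\<in>X. \<forall>y\<in>X. \<forall>z\<in>X. \<rho> x y \<le> K * (\<rho> x z + \<rho> z y)"
    using assms unfolding quasimetric_def by (elim conjE)
  then obtain K where "K \<ge> 1" "\<forall>x\<in>X. \<forall>y\<in>X. \<forall>z\<in>X. \<rho> x y \<le> K * (\<rho> x z + \<rho> z y)"
    by blast
  then have "quasimetric_space X \<rho> K"
    using assms by unfold_locales (auto simp: quasimetric_def)
  then show ?thesis ..
qed

section \<open>The infinite torus\<close>

text \<open>Halving the coordinates keeps the endpoints 0 and 1 apart in the torus.\<close>

definition cube_to_torus :: "(nat \<Rightarrow> real) \<Rightarrow> nat \<Rightarrow> torus"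
  where "cube_to_torus x = (\<lambda>i. to_torus (x i / 2))"

lemma continuous_on_cube_to_torus: "continuous_on S cube_to_torus"
  unfolding cube_to_torus_def
proof (rule continuous_on_coordinatewise_then_product)
  fix i
  have torus: "continuous_on UNIV to_torus"
    by (simp add: continuous_on_open_vimage open_torus_def)
  have "continuous_on S (\<lambda>x :: nat \<Rightarrow> real. x i)"
    by (rule continuous_on_subset[OF continuous_on_product_coordinates subset_UNIV])
  then have "continuous_on S (\<lambda>x :: nat \<Rightarrow> real. x i / 2)"
    by (rule continuous_on_divide[OF _ continuous_on_const]) simp
  then show "continuous_on S (\<lambda>x. to_torus (x i / 2))"
    by (rule continuous_on_compose2[OF torus]) simp
qed

lemma inj_on_cube_to_torus: "inj_on cube_to_torus hilbert_cube"
proof (intro inj_onI ext)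
  fix x y i
  assume xy: "x \<in> hilbert_cube" "y \<in> hilbert_cube" and "cube_to_torus x = cube_to_torus y"
  then have "x i / 2 - y i / 2 \<in> \<int>"
    by (simp add: cube_to_torus_def fun_eq_iff to_torus_eq_iff)
  moreover have "x i \<in> {0..1}" "y i \<in> {0..1}" using xy by (auto simp: hilbert_cube_def)
  \<comment> \<open>The halved coordinates lie in an interval of length 1/2, and 0 is the only
    integer of absolute value below 1.\<close>
  then have "\<bar>x i / 2 - y i / 2\<bar> < 1" unfolding atLeastAtMost_iff by linarith
  ultimately have "x i / 2 - y i / 2 = 0" by (rule Ints_nonzero_abs_less1)
  then show "x i = y i" by simp
qed

theorem theorem1p4:
  fixes \<rho> :: "(nat \<Rightarrow> torus) \<Rightarrow> (nat \<Rightarrow> torus) \<Rightarrow> real"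
  assumes "quasimetric UNIV \<rho>"
    and "quasimetric_topology UNIV \<rho> = product_topology (\<lambda>_::nat. (euclidean :: torus topology)) UNIV"
  shows "\<not> (\<exists>\<mu> :: (nat \<Rightarrow> torus) measure. coifman_weiss_homogeneous UNIV \<rho> \<mu>)"
proof
  assume "\<exists>\<mu> :: (nat \<Rightarrow> torus) measure. coifman_weiss_homogeneous UNIV \<rho> \<mu>"
  then obtain \<mu> where "coifman_weiss_homogeneous UNIV \<rho> \<mu>" ..
  moreover obtain K where "quasimetric_space UNIV \<rho> K"
    using quasimetric_imp_quasimetric_space[OF assms(1)] ..
  \<comment> \<open>By hypothesis the quasimetric topology is the product topology, so
    coordinatewise continuity suffices.\<close>
  moreover have "continuous_map (top_of_set hilbert_cube) (quasimetric_topology UNIV \<rho>) cube_to_torus"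
    by (simp add: assms(2) euclidean_product_topology continuous_on_cube_to_torus)
  ultimately show False
    using quasimetric_space.homogeneous_not_contains_hilbert_cube inj_on_cube_to_torus by blast
qed

end
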